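(* For every $n\geq 1$ and every tree $T_n$ on $n$ vertices, $\#TDDP(T_n)=1$.
   Context: All graphs are finite, simple and connected. A tree is a connected acyclic graph. The diameter of $G$ is the greatest distance between any pair of vertices; a diametral path is a shortest path connecting two vertices whose distance equals the diameter. Two paths are totally disjoint if they have no vertex in common, including their end vertices. $\#TDDP(G)$ denotes the maximum size of a set of pairwise totally disjoint diametral paths in $G$. *)

theory Defs
  imports "Graph_Theory.Graph_Theory"
begin

(* The locale graph consists of the finite symmetric digraphs without loops and parallel
   arcs, i.e. of the finite simple graphs; each undirected edge is a pair of opposite arcs. *)

locale connected_graph = graph +
  assumes connected: "connected G"

(* The constants forest and tree of Graph_Theory are meant for digraphs: in a symmetric digraph
   every edge yields a directed cycle u, v, u of length 2, so forest would exclude all edges.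
   The cycles of an undirected simple graph are those of length at least 3. *)
locale tree_graph = connected_graph +
  assumes acyclic: "\<not> (\<exists>p. cycle p \<and> 3 \<le> length p)"

context wf_digraph
begin

definition distance :: "'a \<Rightarrow> 'a \<Rightarrow> ereal" where
  "distance u v = \<mu> (\<lambda>_. 1) u v"

definition diameter :: ereal where
  "diameter = Max {distance u v | u v. u \<in> verts G \<and> v \<in> verts G}"

(* Paths are given by their lists of vertices, which is unambiguous without parallel arcs;
   a single vertex is a path of length 0. *)
definition shortest_path :: "'a list \<Rightarrow> bool" where
  "shortest_path p \<longleftrightarrow>
     vpath p G \<and> ereal (real (vwalk_length p)) = distance (hd p) (last p)"

definition diametral_path :: "'a list \<Rightarrow> bool" where
  "diametral_path p \<longleftrightarrow> shortest_path p \<and> distance (hd p) (last p) = diameter"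

definition totally_disjoint :: "'a list \<Rightarrow> 'a list \<Rightarrow> bool" where
  "totally_disjoint p q \<longleftrightarrow> set p \<inter> set q = {}"

(* The two vertex lists p and rev p of the same undirected path share vertices, so a
   pairwise totally disjoint set contains at most one of them and no path is counted twice. *)
definition TDDP :: nat where
  "TDDP = Max {card S | S. (\<forall>p\<in>S. diametral_path p) \<and> pairwise totally_disjoint S}"

lemma finite_diametral_paths:
  assumes "finite (verts G)"
  shows "finite {p. diametral_path p}"
proof (rule finite_subset)
  show "{p. diametral_path p} \<subseteq> {p. set p \<subseteq> verts G \<and> distinct p}"
    by (auto simp: diametral_path_def shortest_path_def vpath_def vwalk_def)
  show "finite {p. set p \<subseteq> verts G \<and> distinct p}"
    using assms by (rule finite_subset_distinct)
qed

end

end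

theory Submission
  imports Defs
begin

text \<open>
  In a tree, vertices are joined by exactly one path, so every path is a shortest path. Suppose
  that two diametral paths \<open>p\<close> and \<open>q\<close> of length \<open>d\<close> are disjoint. By connectedness some path leads
  from a vertex \<open>x\<close> of \<open>p\<close> to a vertex \<open>y\<close> of \<open>q\<close> and meets \<open>p\<close> and \<open>q\<close> nowhere else. Prolonging it
  at \<open>x\<close> by the longer half of \<open>p\<close> and at \<open>y\<close> by the longer half of \<open>q\<close>, both of length at least
  \<open>d / 2\<close>, gives a path of length at least \<open>d + 1\<close>, which is absurd.
\<close>

section \<open>Cutting, reversing and halving vertex paths\<close>

lemma vwalk_append_iff:
  assumes "p \<noteq> []" and "q \<noteq> []"
  shows "vwalk (p @ q) G \<longleftrightarrow> vwalk p G \<and> vwalk q G \<and> (last p, hd q) \<in> arcs_ends G"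
  using assms by (auto simp: vwalk_def vwalk_arcs_append)

lemma vpath_append_left: "vpath (p @ q) G \<Longrightarrow> p \<noteq> [] \<Longrightarrow> vpath p G"
  by (auto simp: vpath_def intro: vwalkI_append_l)

lemma vpath_append_right: "vpath (p @ q) G \<Longrightarrow> q \<noteq> [] \<Longrightarrow> vpath q G"
  by (auto simp: vpath_def intro: vwalkI_append_r)

text \<open>Acyclicity speaks of arc lists, the argument below of vertex lists; this is the
  bridge.\<close>

lemma (in wf_digraph) vwalk_imp_awalk:
  assumes "vwalk p G"
  shows "\<exists>es. awalk (hd p) es (last p) \<and> awalk_verts (hd p) es = p"
  using assms
proof (induction p rule: vwalk_induct)
  case (Base u)
  then have "awalk u [] u \<and> awalk_verts u [] = [u]"
    by (simp add: awalk_Nil_iff)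
  then show ?case
    by (metis last_ConsL list.sel(1))
next
  case (Cons u v p)
  then obtain es where es: "awalk v es (last (v # p))" "awalk_verts v es = v # p"
    by (metis list.sel(1))
  from Cons(1) obtain e where "e \<in> arcs G" "tail G e = u" "head G e = v"
    by (auto simp: arcs_ends_conv)
  with es have "awalk u (e # es) (last (u # v # p)) \<and> awalk_verts u (e # es) = u # v # p"
    by (simp add: awalk_Cons_iff)
  then show ?case
    by (metis list.sel(1))
qed

lemma (in sym_digraph) vpath_rev: "vpath p G \<Longrightarrow> vpath (rev p) G"
  by (simp add: vpath_def vwalk_rev_ex[OF sym_arcs])

text \<open>Cutting \<open>p\<close> at \<open>x\<close>, with \<open>x\<close> kept on both sides,
  gives two pieces whose vertex counts add up to \<open>length p + 1\<close>; take the longer one,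
  directed towards \<open>x\<close>.\<close>

lemma (in sym_digraph) vpath_longer_half:
  assumes p: "vpath p G" and x: "x \<in> set p"
  obtains a where "vpath a G" "last a = x" "set a \<subseteq> set p" "Suc (length p) \<le> 2 * length a"
proof -
  obtain p1 p2 where split: "p = p1 @ x # p2"
    using x by (meson split_list)
  have "vpath (p1 @ [x]) G"
    using p vpath_append_left[of "p1 @ [x]" p2 G] split by simp
  moreover have "vpath (rev (x # p2)) G"
    using p vpath_append_right[of p1 "x # p2" G] split vpath_rev by blast
  ultimately show thesis
    using that[of "p1 @ [x]"] that[of "rev (x # p2)"] split by fastforce
qed

section \<open>Uniqueness of paths in a tree\<close>

context tree_graph
begin

lemma verts_nonempty: "verts G \<noteq> {}"
  using connected by (auto simp: connected_def strongly_connected_def)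

lemma reachable_verts: "u \<in> verts G \<Longrightarrow> v \<in> verts G \<Longrightarrow> u \<rightarrow>\<^sup>* v"
  using symmetric_connected_imp_strongly_connected[OF sym_arcs connected]
  by (auto simp: strongly_connected_def)

lemma obtain_vpath:
  assumes "u \<in> verts G" and "v \<in> verts G"
  obtains p where "vpath p G" "hd p = u" "last p = v"
  using reachable_verts[OF assms] by (auto simp: reachable_vpath_conv)

lemma no_closed_vpath:
  assumes p: "vpath p G" and len: "3 \<le> length p"
  shows "(last p, hd p) \<notin> arcs_ends G"
proof
  assume arc: "(last p, hd p) \<in> arcs_ends G"
  have ne: "p \<noteq> []" and "vwalk p G" and d: "distinct p"
    using p by (auto simp: vpath_def vwalk_def)
  moreover from this have "hd p \<in> verts G"
    by (auto simp: vwalk_def)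
  ultimately have "vwalk (p @ [hd p]) G"
    using arc by (simp add: vwalk_append_iff)
  from vwalk_imp_awalk[OF this] obtain es
    where es: "awalk (hd p) es (hd p)" "awalk_verts (hd p) es = p @ [hd p]"
    using ne by auto
  have "length es = length p"
    using arg_cong[OF es(2), of length] by (simp add: length_awalk_verts)
  \<comment> \<open>The tail of \<open>p @ [hd p]\<close> is \<open>p\<close> with its first vertex
    moved to the end.\<close>
  moreover have "distinct (tl (awalk_verts (hd p) es))"
    using ne d es(2) by (cases p) auto
  ultimately have "cycle es" "3 \<le> length es"
    using es(1) len by (auto simp: cycle_def)
  then show False
    using acyclic by blast
qed

text \<open>Induction strips the common first vertex \<open>u\<close>. If the second vertices
  differ, going along one path to the common end and back along the other joins them without meeting
  \<open>u\<close>, and \<open>u\<close> closes this to a cycle.\<close>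

lemma unique_vpath:
  assumes "vpath p G" "vpath q G" "hd p = hd q" "last p = last q"
  shows "p = q"
  using assms
proof (induction p arbitrary: q)
  case Nil
  then show ?case by (auto simp: vpath_def vwalk_def)
next
  case (Cons u p)
  obtain q' where q: "q = u # q'"
    using Cons.prems by (cases q) (auto simp: vpath_def vwalk_def)
  show ?case
  proof (cases "p = [] \<or> q' = []")
    \<comment> \<open>One path is just \<open>u\<close>, so the other ends at \<open>u\<close> too
      and, being distinct, stops there.\<close>
    case True
    then show ?thesis
      using Cons.prems q by (auto simp: vpath_def split: if_splits)
  next
    case False
    then have ne: "p \<noteq> []" "q' \<noteq> []"
      by auto
    have p: "vwalk p G" "(u, hd p) \<in> arcs_ends G" "u \<notin> set p" "vpath p G"
      using Cons.prems(1) ne vwalk_append_iff[of "[u]" p G] by (auto simp: vpath_def)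
    have q': "vwalk q' G" "(u, hd q') \<in> arcs_ends G" "u \<notin> set q'" "vpath q' G"
      using Cons.prems(2) ne q vwalk_append_iff[of "[u]" q' G] by (auto simp: vpath_def)
    have last: "last p = last q'"
      using Cons.prems(4) ne q by simp
    show ?thesis
    proof (cases "hd p = hd q'")
      case True
      then show ?thesis
        using Cons.IH[OF p(4) q'(4) True last] q by simp
    next
      case hd: False
      have "vwalk (rev q') G"
        using vwalk_rev_ex[OF sym_arcs q'(1)] .
      then have w: "vwalk (p \<oplus> rev q') G"
        using p(1) ne last by (intro vwalk_joinI_vwalk) (auto simp: hd_rev)
      \<comment> \<open>The joined walk may repeat vertices; shortening it to a path keeps its ends
        and adds no vertex, so \<open>u\<close> is still avoided.\<close>
      define r where "r = vwalk_to_vpath (p \<oplus> rev q')"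
      have r: "vpath r G"
        unfolding r_def by (rule vwalk_to_vpath_vpath[OF w])
      have hd_r: "hd r = hd p"
        unfolding r_def using ne by (simp add: vwalk_to_vpath_hd vwalk_join_hd')
      have last_r: "last r = hd q'"
        unfolding r_def using ne last
        by (subst vwalk_to_vpath_last, subst vwalk_join_last) (auto simp: last_rev hd_rev)
      have "set r \<subseteq> set (p \<oplus> rev q')"
        unfolding r_def using vwalk_to_vpath_subset by fast
      also have "\<dots> \<subseteq> set p \<union> set q'"
        unfolding vwalk_join_def using ne by (cases "rev q'") (auto dest: arg_cong[of _ _ set])
      finally have "u \<notin> set r"
        using p(3) q'(3) by blast
      have r_ne: "r \<noteq> []"
        using r by (auto simp: vpath_def vwalk_def)
      \<comment> \<open>The ends of \<open>r\<close> differ, so together with \<open>u\<close> there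
        are the three vertices that a cycle needs.\<close>
      then have "2 \<le> length r"
        using hd hd_r last_r by (cases r; cases "tl r") auto
      then have "3 \<le> length (u # r)"
        by simp
      moreover have "vpath (u # r) G"
        using r r_ne \<open>u \<notin> set r\<close> p(2) hd_r vwalk_wf_digraph_consI[of r u]
        by (auto simp: vpath_def)
      ultimately have "(last (u # r), hd (u # r)) \<notin> arcs_ends G"
        using no_closed_vpath by blast
      moreover have "(hd q', u) \<in> arcs_ends G"
        using arcs_ends_symmetric[OF sym_arcs] q'(2) by blast
      ultimately show ?thesis
        using r_ne last_r by simp
    qed
  qed
qed

section \<open>Distances and the diameter in terms of path lengths\<close>

lemma distance_vpath:
  assumes p: "vpath p G"
  shows "distance (hd p) (last p) = ereal (real (vwalk_length p))"
proof -
  have "hd p \<in> verts G" "last p \<in> verts G"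
    using p by (auto simp: vpath_def vwalk_def)
  \<comment> \<open>The distance is attained by some path; by uniqueness its vertex list can only be
    \<open>p\<close>.\<close>
  then obtain es where es: "apath (hd p) es (last p)"
      "\<mu> (\<lambda>_. 1) (hd p) (last p) = awalk_cost (\<lambda>_. 1) es"
    using min_cost_awalk[of "hd p" "last p" "\<lambda>_. 1"] reachable_verts by auto
  have "vpath (awalk_verts (hd p) es) G"
    using es(1) by (auto simp: apath_def vpath_def awalk_imp_vwalk)
  then have "awalk_verts (hd p) es = p"
    using es(1) p by (intro unique_vpath) (auto simp: apath_def)
  then have "vwalk_length p = length es"
    using length_awalk_verts[of "hd p" es] by simp
  moreover have "awalk_cost (\<lambda>_. 1) es = real (length es)"
    by (induction es) auto
  ultimately show ?thesis
    using es(2) by (simp add: distance_def)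
qed

lemma finite_distances: "finite {distance u v | u v. u \<in> verts G \<and> v \<in> verts G}"
  by (rule finite_image_set2) auto

lemma vpath_length_le_diametral_path:
  assumes q: "vpath q G" and p: "diametral_path p"
  shows "length q \<le> length p"
proof -
  have "hd q \<in> verts G" "last q \<in> verts G"
    using q by (auto simp: vpath_def vwalk_def)
  then have "distance (hd q) (last q) \<le> diameter"
    unfolding diameter_def using finite_distances by (intro Max_ge) auto
  also have "diameter = ereal (real (vwalk_length p))"
    using p by (simp add: diametral_path_def shortest_path_def)
  finally have "length q - 1 \<le> length p - 1"
    using distance_vpath[OF q] by simp
  \<comment> \<open>Subtraction is truncated, so the 1 cancels only for nonempty
    \<open>p\<close>.\<close>
  moreover have "p \<noteq> []"
    using p by (auto simp: diametral_path_def shortest_path_def vpath_def vwalk_def)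
  ultimately show ?thesis
    by (cases p) auto
qed

lemma diametral_path_exists: "\<exists>p. diametral_path p"
proof -
  have "diameter \<in> {distance u v | u v. u \<in> verts G \<and> v \<in> verts G}"
    unfolding diameter_def using finite_distances verts_nonempty by (intro Max_in) auto
  then obtain u v where uv: "u \<in> verts G" "v \<in> verts G" "diameter = distance u v"
    by auto
  then obtain p where "vpath p G" "hd p = u" "last p = v"
    using obtain_vpath by metis
  then show ?thesis
    using uv(3) distance_vpath by (auto simp: diametral_path_def shortest_path_def)
qed

section \<open>Disjoint diametral paths\<close>

lemma diametral_paths_meet:
  assumes p: "diametral_path p" and q: "diametral_path q"
  shows "set p \<inter> set q \<noteq> {}"
proof
  assume disj: "set p \<inter> set q = {}"
  have vp: "vpath p G" and vq: "vpath q G"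
    using p q by (auto simp: diametral_path_def shortest_path_def)
  then have ends: "hd p \<in> set p" "hd q \<in> set q" "hd p \<in> verts G" "hd q \<in> verts G"
    by (auto simp: vpath_def vwalk_def)
  then obtain r where r: "vpath r G" "hd r = hd p" "last r = hd q"
    using obtain_vpath by metis
  have r_ne: "r \<noteq> []"
    using r(1) by (auto simp: vpath_def vwalk_def)
  then have "\<exists>x\<in>set r. x \<in> set p"
    using r(2) ends(1) by (metis hd_in_set)
  \<comment> \<open>\<open>x\<close> is the last vertex of \<open>r\<close> on \<open>p\<close>, and
    \<open>y\<close> below the first one after it on \<open>q\<close>; hence \<open>c\<close>, the
    part strictly between, avoids both paths.\<close>
  then obtain r1 x r2 where s1: "r = r1 @ x # r2" "x \<in> set p" "\<forall>z\<in>set r2. z \<notin> set p"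
    by (rule split_list_last_propE) blast
  have "r2 \<noteq> []"
    using s1 r(3) ends(2) disj by auto
  then have "hd q \<in> set r2"
    using s1(1) r(3) by (metis last_ConsR last_appendR last_in_set list.discI)
  then have "\<exists>y\<in>set r2. y \<in> set q"
    using ends(2) by blast
  then obtain c y r3 where s2: "r2 = c @ y # r3" "y \<in> set q" "\<forall>z\<in>set c. z \<notin> set q"
    by (rule split_list_first_propE) blast
  obtain a where a: "vpath a G" "last a = x" "set a \<subseteq> set p" "Suc (length p) \<le> 2 * length a"
    using vpath_longer_half[OF vp s1(2)] .
  obtain b where b: "vpath b G" "last b = y" "set b \<subseteq> set q" "Suc (length q) \<le> 2 * length b"
    using vpath_longer_half[OF vq s2(2)] .
  have ne: "a \<noteq> []" "b \<noteq> []"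
    using a(1) b(1) by (auto simp: vpath_def vwalk_def)
  have rb: "vwalk (rev b) G" "hd (rev b) = y"
    using vpath_rev[OF b(1)] b(2) by (auto simp: vpath_def hd_rev)
  have "vpath (([x] @ c @ [y]) @ r3) G"
    using r(1) vpath_append_right[of r1 "x # r2" G] s1(1) s2(1) by simp
  then have "vpath ([x] @ c @ [y]) G"
    by (rule vpath_append_left) simp
  then have xcy: "vwalk ([x] @ c @ [y]) G" "distinct c"
    by (auto simp: vpath_def)
  \<comment> \<open>The linking arcs come from the segment \<open>[x] @ c @ [y]\<close>; for empty
    \<open>c\<close> it is the single arc from \<open>x\<close> to \<open>y\<close>.\<close>
  have "vwalk (a @ c @ rev b) G"
  proof (cases "c = []")
    case True
    then show ?thesis
      using xcy(1) a ne rb by (auto simp: vwalk_append_iff vpath_def)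
  next
    case False
    then show ?thesis
      using xcy(1) a ne rb vwalk_append_iff[of "[x]" "c @ [y]" G]
      by (auto simp: vwalk_append_iff vpath_def)
  qed
  moreover have "distinct (a @ c @ rev b)"
    using xcy(2) a b s1(3) s2 disj by (auto simp: vpath_def)
  ultimately have "length (a @ c @ rev b) \<le> length p"
    by (intro vpath_length_le_diametral_path[OF _ p]) (simp add: vpath_def)
  \<comment> \<open>Then \<open>2 * (length a + length b)\<close> is at least
    \<open>2 * length p + 2\<close>, so the new path has more vertices than
    \<open>p\<close>.\<close>
  moreover have "length p \<le> length q"
    using vpath_length_le_diametral_path[OF vp q] .
  ultimately show False
    using a(4) b(4) by simp
qed

lemma TDDP_eq_1: "TDDP = 1"
proof -
  define F where "F = {S. (\<forall>p\<in>S. diametral_path p) \<and> pairwise totally_disjoint S}"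
  have card_le: "card S \<le> 1" if "S \<in> F" for S
  \<comment> \<open>An infinite \<open>S\<close> has \<open>card S = 0\<close> by
    convention.\<close>
  proof (cases "finite S")
    case True
    have "p = q" if "p \<in> S" "q \<in> S" for p q
      using \<open>S \<in> F\<close> that diametral_paths_meet[of p q]
      unfolding F_def pairwise_def totally_disjoint_def by blast
    with True show ?thesis
      by (simp add: card_le_Suc0_iff_eq)
  qed simp
  obtain p where "diametral_path p"
    using diametral_path_exists by blast
  then have "{p} \<in> F"
    by (simp add: F_def pairwise_def)
  have "Max (card ` F) = 1"
  \<comment> \<open>The cardinalities lie in {0, 1}, and a singleton attains 1 since it is vacuously
    pairwise disjoint.\<close>
  proof (rule Max_eqI)
    have "card ` F \<subseteq> {..1}"
      using card_le by blast
    then show "finite (card ` F)"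
      using finite_subset by blast
    show "1 \<in> card ` F"
      using \<open>{p} \<in> F\<close> by (rule rev_image_eqI) simp
  qed (use card_le in blast)
  then show ?thesis
    by (simp add: TDDP_def F_def setcompr_eq_image)
qed

end

theorem theorem2:
  fixes T :: "('a, 'b) pre_digraph" and n :: nat
  assumes "n \<ge> 1"
    and "tree_graph T"
    and "card (verts T) = n"
  shows "wf_digraph.TDDP T = 1"
  using tree_graph.TDDP_eq_1[OF assms(2)] .

end
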